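(* Let $(H,[-,-,-]_H,\{-,-,-\}_H)$ be a 3-Leibniz-Lie algebra over a field $\mathbb{K}$ of characteristic $0$. Then the trilinear product $\langle -,-,-\rangle_H : H\otimes H\otimes H\to H$ given by $$\langle h_1,h_2,h_3\rangle_H := [h_1,h_2,h_3]_H+\{h_1,h_2,h_3\}_H,\qquad h_1,h_2,h_3\in H,$$ defines a 3-Leibniz algebra structure on $H$.
   Context: All vector spaces are over a field $\mathbb{K}$ of characteristic $0$. A 3-Lie algebra $(L,[-,-,-]_L)$ is a vector space $L$ with a skew-symmetric trilinear map $[-,-,-]_L:\wedge^3L\to L$ such that for all $l_i\in L$ $$[l_1,l_2,[l_3,l_4,l_5]_L]_L=[[l_1,l_2,l_3]_L,l_4,l_5]_L+[l_3,[l_1,l_2,l_4]_L,l_5]_L+[l_3,l_4,[l_1,l_2,l_5]_L]_L.$$ A 3-Leibniz algebra is a vector space with a trilinear operation (no symmetry required) satisfying this same identity. A 3-Leibniz-Lie algebra $(H,[-,-,-]_H,\{-,-,-\}_H)$ consists of a 3-Lie algebra $(H,[-,-,-]_H)$ and a trilinear product $\{-,-,-\}_H:H\otimes H\otimes H\to H$ such that for all $h_1,\dots,h_5\in H$ $$\{h_1,h_2,\{h_3,h_4,h_5\}_H\}_H=\{\{h_1,h_2,h_3\}_H,h_4,h_5\}_H+\{h_3,\{h_1,h_2,h_4\}_H,h_5\}_H+\{h_3,h_4,\{h_1,h_2,h_5\}_H\}_H+\{[h_1,h_2,h_3]_H,h_4,h_5\}_H+\{h_3,[h_1,h_2,h_4]_H,h_5\}_H,$$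 $$\{h_1,h_2,[h_3,h_4,h_5]_H\}_H=[\{h_1,h_2,h_3\}_H,h_4,h_5]_H=0.$$ *)

theory Defs
  imports Complex_Main
begin

text \<open>
  Algebras live on a whole type \<open>'v\<close>, made into a vector space over a field \<open>'k\<close> by the scalar
  multiplication \<open>scale\<close>.
\<close>

locale trilinear_product = vector_space scale
  for scale :: "'k::field \<Rightarrow> 'v::ab_group_add \<Rightarrow> 'v" +
  fixes m :: "'v \<Rightarrow> 'v \<Rightarrow> 'v \<Rightarrow> 'v"
  assumes linear_1: "Vector_Spaces.linear scale scale (\<lambda>x. m x y z)"
    and linear_2: "Vector_Spaces.linear scale scale (\<lambda>y. m x y z)"
    and linear_3: "Vector_Spaces.linear scale scale (\<lambda>z. m x y z)"

locale three_leibniz_algebra = trilinear_product scale m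
  for scale :: "'k::field_char_0 \<Rightarrow> 'v::ab_group_add \<Rightarrow> 'v"
    and m :: "'v \<Rightarrow> 'v \<Rightarrow> 'v \<Rightarrow> 'v" +
  assumes fundamental_identity:
    "m x1 x2 (m x3 x4 x5) =
       m (m x1 x2 x3) x4 x5 + m x3 (m x1 x2 x4) x5 + m x3 x4 (m x1 x2 x5)"

text \<open>
  Skew-symmetry is required for the two adjacent transpositions, which generate all permutations
  of the three arguments.  In characteristic 0 this is the same as being alternating, i.e. as
  factoring through the third exterior power.
\<close>

locale three_lie_algebra = trilinear_product scale br
  for scale :: "'k::field_char_0 \<Rightarrow> 'v::ab_group_add \<Rightarrow> 'v"
    and br :: "'v \<Rightarrow> 'v \<Rightarrow> 'v \<Rightarrow> 'v" +
  assumes skew_12: "br x y z = - br y x z"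
    and skew_23: "br x y z = - br x z y"
    and fundamental_identity:
    "br x1 x2 (br x3 x4 x5) =
       br (br x1 x2 x3) x4 x5 + br x3 (br x1 x2 x4) x5 + br x3 x4 (br x1 x2 x5)"

locale three_leibniz_lie_algebra =
  three_lie_algebra scale br + product: trilinear_product scale tp
  for scale :: "'k::field_char_0 \<Rightarrow> 'v::ab_group_add \<Rightarrow> 'v"
    and br :: "'v \<Rightarrow> 'v \<Rightarrow> 'v \<Rightarrow> 'v"
    and tp :: "'v \<Rightarrow> 'v \<Rightarrow> 'v \<Rightarrow> 'v" +
  assumes product_identity:
    "tp h1 h2 (tp h3 h4 h5) =
       tp (tp h1 h2 h3) h4 h5 + tp h3 (tp h1 h2 h4) h5 + tp h3 h4 (tp h1 h2 h5)
       + tp (br h1 h2 h3) h4 h5 + tp h3 (br h1 h2 h4) h5"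
    and product_bracket_zero: "tp h1 h2 (br h3 h4 h5) = 0"
    and bracket_product_zero: "br (tp h1 h2 h3) h4 h5 = 0"

end

theory Submission
  imports Defs
begin

text \<open>Expand the fundamental identity of \<open>br + tp\<close> by trilinearity. Any
  \<open>br\<close> with a \<open>tp\<close> value among its arguments vanishes, and so does
  \<open>tp\<close> with a \<open>br\<close> value in its last slot. The pure \<open>br\<close>
  terms form the 3-Lie identity; everything else is exactly \<open>product_identity\<close>, whose
  two extra terms are the surviving mixed ones.\<close>

context trilinear_product
begin

lemma add_1: "m (a + b) y z = m a y z + m b y z"
  using linear_1 by (rule Vector_Spaces.linear.axioms(3)[THEN module_hom.add])

lemma add_2: "m x (a + b) z = m x a z + m x b z"
  using linear_2 by (rule Vector_Spaces.linear.axioms(3)[THEN module_hom.add])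

lemma add_3: "m x y (a + b) = m x y a + m x y b"
  using linear_3 by (rule Vector_Spaces.linear.axioms(3)[THEN module_hom.add])

text \<open>Supplies the trilinearity half of the conclusion: in each slot, a pointwise sum of
  linear maps is linear.\<close>

lemma trilinear_product_add:
  assumes "trilinear_product scale n"
  shows "trilinear_product scale (\<lambda>x y z. m x y z + n x y z)"
proof -
  interpret n: trilinear_product scale n by fact
  interpret vector_space_pair scale scale ..
  show ?thesis
    by (intro trilinear_product.intro trilinear_product_axioms.intro vector_space_axioms
        linear_compose_add linear_1 linear_2 linear_3 n.linear_1 n.linear_2 n.linear_3)
qed

end

theorem theorem3p4:
  fixes scale :: "'k::field_char_0 \<Rightarrow> 'h::ab_group_add \<Rightarrow> 'h"
    and br tp :: "'h \<Rightarrow> 'h \<Rightarrow> 'h \<Rightarrow> 'h"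
  assumes "three_leibniz_lie_algebra scale br tp"
  shows "three_leibniz_algebra scale (\<lambda>h1 h2 h3. br h1 h2 h3 + tp h1 h2 h3)"
proof -
  interpret three_leibniz_lie_algebra scale br tp by fact
  interpret sum: trilinear_product scale "\<lambda>h1 h2 h3. br h1 h2 h3 + tp h1 h2 h3"
    using product.trilinear_product_axioms by (rule trilinear_product_add)
  \<comment> \<open>The axiom kills \<open>tp\<close> values only in the first slot of
    \<open>br\<close>; skew-symmetry carries this to the other two.\<close>
  have zero_2: "br x (tp a b c) y = 0" for x y a b c
    using skew_12[of x "tp a b c" y] by (simp add: bracket_product_zero)
  have zero_3: "br x y (tp a b c) = 0" for x y a b c
    using skew_23[of x y "tp a b c"] by (simp add: zero_2)
  show ?thesis
  proof
    fix x1 x2 x3 x4 x5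
    show "br x1 x2 (br x3 x4 x5 + tp x3 x4 x5) + tp x1 x2 (br x3 x4 x5 + tp x3 x4 x5) =
      br (br x1 x2 x3 + tp x1 x2 x3) x4 x5 + tp (br x1 x2 x3 + tp x1 x2 x3) x4 x5 +
      (br x3 (br x1 x2 x4 + tp x1 x2 x4) x5 + tp x3 (br x1 x2 x4 + tp x1 x2 x4) x5) +
      (br x3 x4 (br x1 x2 x5 + tp x1 x2 x5) + tp x3 x4 (br x1 x2 x5 + tp x1 x2 x5))"
      \<comment> \<open>After expansion and removal of the vanishing terms, the goal is the sum of
        these two identities.\<close>
      using fundamental_identity[of x1 x2 x3 x4 x5] product_identity[of x1 x2 x3 x4 x5]
      by (simp add: add_1 add_2 add_3 product.add_1 product.add_2 product.add_3
          bracket_product_zero zero_2 zero_3 product_bracket_zero algebra_simps)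
  qed
qed

end
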